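(* Let $\mathbf{W}=\mathbf{W}^{\mathrm{pt}}+\mathbf{A}\mathbf{B}^\top=\tilde{\mathbf{W}}^{\mathrm{pt}}+\tilde{\mathbf{A}}\tilde{\mathbf{B}}^\top\in\mathbb{R}^{m\times n}$ with $\mathbf{A}\in\mathbb{R}^{m\times r}$, $\mathbf{B}\in\mathbb{R}^{n\times r}$, $\tilde{\mathbf{A}}=\mathbf{A}\operatorname{diag}(\boldsymbol{\alpha})$ and $\tilde{\mathbf{B}}=\mathbf{B}\operatorname{diag}(\boldsymbol{\beta})$, where $\boldsymbol{\alpha},\boldsymbol{\beta}\in\mathbb{R}^r$. Then the first and second gradient moment estimators of $(\tilde{\mathbf{A}},\tilde{\mathbf{B}})$ can be computed from those of $(\mathbf{A},\mathbf{B})$ (given $\boldsymbol{\alpha},\boldsymbol{\beta}$) within $\mathcal{O}((m+n)r)$ time.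
   Context: Here $\ell:\mathbb{R}^{m\times n}\to\mathbb{R}$ is a differentiable loss. By the chain rule, the gradients of the loss with respect to the adapters are $\nabla_{\mathbf{A}}\ell(\mathbf{W})=\nabla\ell(\mathbf{W})\mathbf{B}$ and $\nabla_{\mathbf{B}}\ell(\mathbf{W})=\nabla\ell(\mathbf{W})^\top\mathbf{A}$, and likewise $\nabla_{\tilde{\mathbf{A}}}\ell(\mathbf{W})=\nabla\ell(\mathbf{W})\tilde{\mathbf{B}}$ and $\nabla_{\tilde{\mathbf{B}}}\ell(\mathbf{W})=\nabla\ell(\mathbf{W})^\top\tilde{\mathbf{A}}$. $\mathbf{W},\mathbf{A},\mathbf{B}$ are viewed as stochastic matrices observed along a trajectory $(\mathbf{W}_\tau,\mathbf{A}_\tau,\mathbf{B}_\tau)$, $\tau=0,\dots,t$; the scaling factors are fixed and applied at every $\tau$, i.e. $\tilde{\mathbf{A}}_\tau=\mathbf{A}_\tau\operatorname{diag}(\boldsymbol{\alpha})$, $\tilde{\mathbf{B}}_\tau=\mathbf{B}_\tau\operatorname{diag}(\boldsymbol{\beta})$. With fixed decay parameters $\rho_1,\rho_2\in(0,1)$, the first and second gradient moment estimators at time $t$ of $\mathbf{A}$ are the exponential moving averages $m_t(\nabla\ell(\mathbf{W})\mathbf{B})=(1-\rho_1)\sum_{\tau=0}^t\rho_1^{t-\tau}\nabla\ell(\mathbf{W}_\tau)\mathbf{B}_\tau$ and $v_t(\nabla\ell(\mathbf{W})\mathbf{B})=(1-\rho_2)\sum_{\tau=0}^t\rho_2^{t-\tau}[\nabla\ell(\mathbf{W}_\tau)\mathbf{B}_\tau]^{\circ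 2}$, and those of $\mathbf{B}$ are $m_t(\nabla\ell(\mathbf{W})^\top\mathbf{A})=(1-\rho_1)\sum_{\tau=0}^t\rho_1^{t-\tau}\nabla\ell(\mathbf{W}_\tau)^\top\mathbf{A}_\tau$ and $v_t(\nabla\ell(\mathbf{W})^\top\mathbf{A})=(1-\rho_2)\sum_{\tau=0}^t\rho_2^{t-\tau}[\nabla\ell(\mathbf{W}_\tau)^\top\mathbf{A}_\tau]^{\circ 2}$, where $\cdot^{\circ 2}$ is the entrywise square. Those of $\tilde{\mathbf{A}}$ and $\tilde{\mathbf{B}}$ are defined by the same formulas with $\mathbf{B}_\tau,\mathbf{A}_\tau$ replaced by $\tilde{\mathbf{B}}_\tau,\tilde{\mathbf{A}}_\tau$. $\operatorname{diag}(\mathbf{v})$ is the diagonal matrix with diagonal $\mathbf{v}$. Time counts arithmetic operations. *)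

theory Defs
  imports Complex_Main "Jordan_Normal_Form.Matrix"
begin

text \<open>The dimensions \<open>m\<close>, \<open>n\<close>, \<open>r\<close> have to be quantified inside the statement (the constant hidden in
  the \<open>O\<close> must not depend on them), so matrices are \<open>real mat\<close> with explicit carriers. This type
  carries no norm, hence Frechet differentiability is spelled out with respect to the Frobenius
  inner product and norm.\<close>

definition frobenius_inner :: "real mat \<Rightarrow> real mat \<Rightarrow> real" where
  "frobenius_inner X Y = (\<Sum>i<dim_row X. \<Sum>j<dim_col X. X $$ (i,j) * Y $$ (i,j))"

definition frobenius_norm :: "real mat \<Rightarrow> real" where
  "frobenius_norm X = sqrt (frobenius_inner X X)"

definition has_gradient :: "(real mat \<Rightarrow> real) \<Rightarrow> real mat \<Rightarrow> real mat \<Rightarrow> bool" where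
  "has_gradient loss G W \<longleftrightarrow>
     G \<in> carrier_mat (dim_row W) (dim_col W) \<and>
     (\<forall>e>0. \<exists>d>0. \<forall>H \<in> carrier_mat (dim_row W) (dim_col W). frobenius_norm H < d \<longrightarrow>
        \<bar>loss (W + H) - loss W - frobenius_inner G H\<bar> \<le> e * frobenius_norm H)"

definition differentiable_loss :: "nat \<Rightarrow> nat \<Rightarrow> (real mat \<Rightarrow> real) \<Rightarrow> bool" where
  "differentiable_loss m n loss \<longleftrightarrow> (\<forall>W \<in> carrier_mat m n. \<exists>G. has_gradient loss G W)"

definition grad :: "(real mat \<Rightarrow> real) \<Rightarrow> real mat \<Rightarrow> real mat" where
  "grad loss W = (SOME G. has_gradient loss G W)"

definition diag :: "real vec \<Rightarrow> real mat" where
  "diag v = mat_diag (dim_vec v) (\<lambda>i. v $ i)"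

text \<open>The gradients of the loss with respect to the adapters \<open>A\<close> and \<open>B\<close> at
  \<open>W = Wpt + A B\<^sup>T\<close>, in the form the chain rule gives them.\<close>

definition grad_A :: "(real mat \<Rightarrow> real) \<Rightarrow> real mat \<Rightarrow> real mat \<Rightarrow> real mat" where
  "grad_A loss W B = grad loss W * B"

definition grad_B :: "(real mat \<Rightarrow> real) \<Rightarrow> real mat \<Rightarrow> real mat \<Rightarrow> real mat" where
  "grad_B loss W A = transpose_mat (grad loss W) * A"

text \<open>Exponential moving average, at time \<open>t\<close>, of the matrices \<open>X 0, \<dots>, X t\<close>, which are meant to have
  equal dimensions.\<close>

definition ema :: "real \<Rightarrow> nat \<Rightarrow> (nat \<Rightarrow> real mat) \<Rightarrow> real mat" where
  "ema \<rho> t X = mat (dim_row (X t)) (dim_col (X t))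
     (\<lambda>(i,j). (1 - \<rho>) * (\<Sum>\<tau>=0..t. \<rho> ^ (t - \<tau>) * X \<tau> $$ (i,j)))"

definition first_moment :: "real \<Rightarrow> nat \<Rightarrow> (nat \<Rightarrow> real mat) \<Rightarrow> real mat" where
  "first_moment \<rho>1 t X = ema \<rho>1 t X"

definition second_moment :: "real \<Rightarrow> nat \<Rightarrow> (nat \<Rightarrow> real mat) \<Rightarrow> real mat" where
  "second_moment \<rho>2 t X = ema \<rho>2 t (\<lambda>\<tau>. map_mat (\<lambda>x. x\<^sup>2) (X \<tau>))"

text \<open>Algorithms are programs over named two-dimensional arrays of reals, built from arithmetic
  instructions and bounded loops. A single program serves all dimensions: loop bounds are looked up
  in the environment of natural numbers, which also holds the loop counters. Programs cannot modify
  the environment other than through loop counters, and control flow never depends on the reals.\<close>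

type_synonym env = "string \<Rightarrow> nat"
type_synonym store = "string \<Rightarrow> nat \<Rightarrow> nat \<Rightarrow> real"

datatype index = Lit nat | Var string

fun index_val :: "env \<Rightarrow> index \<Rightarrow> nat" where
  "index_val \<sigma> (Lit k) = k"
| "index_val \<sigma> (Var x) = \<sigma> x"

datatype cell = Cell string index index

fun get_cell :: "env \<Rightarrow> store \<Rightarrow> cell \<Rightarrow> real" where
  "get_cell \<sigma> s (Cell a i j) = s a (index_val \<sigma> i) (index_val \<sigma> j)"

fun set_cell :: "env \<Rightarrow> store \<Rightarrow> cell \<Rightarrow> real \<Rightarrow> store" where
  "set_cell \<sigma> s (Cell a i j) x =
     s(a := (s a)(index_val \<sigma> i := (s a (index_val \<sigma> i))(index_val \<sigma> j := x)))"

datatype arith_op = Add | Sub | Mul | Div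

fun apply_op :: "arith_op \<Rightarrow> real \<Rightarrow> real \<Rightarrow> real" where
  "apply_op Add x y = x + y"
| "apply_op Sub x y = x - y"
| "apply_op Mul x y = x * y"
| "apply_op Div x y = x / y"

datatype program =
    Load cell real
  | Arith cell arith_op cell cell
  | Seq program program
  | For string string program

text \<open>\<open>For x y c\<close> runs \<open>c\<close> with \<open>x\<close> bound successively to \<open>0, \<dots>, y - 1\<close>, where \<open>y\<close> is looked up
  in the environment.\<close>

primrec exec :: "program \<Rightarrow> env \<Rightarrow> store \<Rightarrow> store" where
  "exec (Load d x) \<sigma> s = set_cell \<sigma> s d x"
| "exec (Arith d f a b) \<sigma> s = set_cell \<sigma> s d (apply_op f (get_cell \<sigma> s a) (get_cell \<sigma> s b))"
| "exec (Seq c1 c2) \<sigma> s = exec c2 \<sigma> (exec c1 \<sigma> s)"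
| "exec (For x y c) \<sigma> s = fold (\<lambda>k. exec c (\<sigma>(x := k))) [0..<\<sigma> y] s"

text \<open>Every arithmetic operation costs one unit; so does every loading of a constant and every loop
  iteration (for the increment of the loop counter).\<close>

primrec time :: "program \<Rightarrow> env \<Rightarrow> nat" where
  "time (Load d x) \<sigma> = 1"
| "time (Arith d f a b) \<sigma> = 1"
| "time (Seq c1 c2) \<sigma> = time c1 \<sigma> + time c2 \<sigma>"
| "time (For x y c) \<sigma> = (\<Sum>k<\<sigma> y. time c (\<sigma>(x := k)) + 1)"

definition stores_mat :: "store \<Rightarrow> string \<Rightarrow> real mat \<Rightarrow> bool" where
  "stores_mat s a M \<longleftrightarrow> (\<forall>i<dim_row M. \<forall>j<dim_col M. s a i j = M $$ (i,j))"

text \<open>A vector occupies row \<open>0\<close> of its array.\<close>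

definition stores_vec :: "store \<Rightarrow> string \<Rightarrow> real vec \<Rightarrow> bool" where
  "stores_vec s a v \<longleftrightarrow> (\<forall>j<dim_vec v. s a 0 j = v $ j)"

end

theory Submission
  imports Defs
begin

text \<open>The loss gradient depends on the adapters only through \<open>W\<close>, which both factorizations share. Hence
  \<open>\<nabla>\<^sub>A\<close> of the scaled adapters is \<open>\<nabla>\<^sub>A\<close> of the original ones times \<open>diag \<beta>\<close>, i.e. its columns are
  scaled, and likewise for \<open>\<nabla>\<^sub>B\<close> and \<open>diag \<alpha>\<close>. Exponential moving averages are linear, so first
  moments are multiplied by the diagonal matrix once; entrywise squaring turns a column scaling into
  the same scaling applied twice, so second moments are multiplied by it twice. Each scaling is one
  pass over an array with \<open>m r\<close> or \<open>n r\<close> entries.\<close>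

section \<open>Moments under column scaling\<close>

lemma diag_carrier: "v \<in> carrier_vec r \<Longrightarrow> diag v \<in> carrier_mat r r"
  by (auto simp: diag_def)

lemma index_mult_diag:
  assumes "M \<in> carrier_mat k r" "v \<in> carrier_vec r" "i < k" "j < r"
  shows "(M * diag v) $$ (i,j) = M $$ (i,j) * v $ j"
  using assms by (auto simp: diag_def mat_diag_mult_right[of M k r])

lemma ema_carrier: "X t \<in> carrier_mat k r \<Longrightarrow> ema \<rho> t X \<in> carrier_mat k r"
  by (auto simp: ema_def)

text \<open>The factor \<open>v $ j\<close> is the same at every time, so it can be pulled out of
  the weighted sum for entry \<open>(i,j)\<close>.\<close>

lemma ema_mult_diag:
  assumes X: "\<And>\<tau>. \<tau> \<le> t \<Longrightarrow> X \<tau> \<in> carrier_mat k r"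
    and v: "v \<in> carrier_vec r"
    and Y: "\<And>\<tau>. \<tau> \<le> t \<Longrightarrow> Y \<tau> = X \<tau> * diag v"
  shows "ema \<rho> t Y = ema \<rho> t X * diag v"
proof (rule eq_matI)
  have Xt: "X t \<in> carrier_mat k r" and D: "diag v \<in> carrier_mat r r"
    using X v by (auto intro: diag_carrier)
  then have Yt: "Y t \<in> carrier_mat k r" using Y by simp
  show "dim_row (ema \<rho> t Y) = dim_row (ema \<rho> t X * diag v)"
    "dim_col (ema \<rho> t Y) = dim_col (ema \<rho> t X * diag v)"
    using Xt Yt D by (auto simp: ema_def)
  fix i j assume "i < dim_row (ema \<rho> t X * diag v)" "j < dim_col (ema \<rho> t X * diag v)"
  then have ij: "i < k" "j < r" using Xt D by (auto simp: ema_def)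
  have "(\<Sum>\<tau>=0..t. \<rho> ^ (t - \<tau>) * Y \<tau> $$ (i,j)) = (\<Sum>\<tau>=0..t. \<rho> ^ (t - \<tau>) * X \<tau> $$ (i,j)) * v $ j"
    unfolding sum_distrib_right
    by (rule sum.cong) (auto simp: Y index_mult_diag[OF X v ij])
  then have "ema \<rho> t Y $$ (i,j) = ema \<rho> t X $$ (i,j) * v $ j"
    using ij Xt Yt by (simp add: ema_def)
  then show "ema \<rho> t Y $$ (i,j) = (ema \<rho> t X * diag v) $$ (i,j)"
    using index_mult_diag[OF ema_carrier[of X t k r, OF Xt] v ij] by simp
qed

text \<open>Squaring an entry squares its factor \<open>v $ j\<close>. Two products with
  \<open>diag v\<close>, instead of one with the squared vector, match a program that scales twice
  from the same array.\<close>

lemma map_mat_square_mult_diag: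
  assumes M: "M \<in> carrier_mat k r" and v: "v \<in> carrier_vec r"
  shows "map_mat (\<lambda>x::real. x\<^sup>2) (M * diag v) = map_mat (\<lambda>x. x\<^sup>2) M * diag v * diag v"
proof (rule eq_matI)
  have D: "diag v \<in> carrier_mat r r" using v by (rule diag_carrier)
  have S: "map_mat (\<lambda>x. x\<^sup>2) M \<in> carrier_mat k r" using M by simp
  fix i j assume "i < dim_row (map_mat (\<lambda>x. x\<^sup>2) M * diag v * diag v)"
    "j < dim_col (map_mat (\<lambda>x. x\<^sup>2) M * diag v * diag v)"
  then have ij: "i < k" "j < r" using M D by auto
  have "(map_mat (\<lambda>x. x\<^sup>2) M * diag v * diag v) $$ (i,j) = (M $$ (i,j))\<^sup>2 * v $ j * v $ j"
    using index_mult_diag[OF S v ij] index_mult_diag[OF mult_carrier_mat[OF S D] v ij] ij M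
    by simp
  moreover have "map_mat (\<lambda>x. x\<^sup>2) (M * diag v) $$ (i,j) = ((M * diag v) $$ (i,j))\<^sup>2"
    using ij M D by simp
  ultimately show "map_mat (\<lambda>x. x\<^sup>2) (M * diag v) $$ (i,j)
      = (map_mat (\<lambda>x. x\<^sup>2) M * diag v * diag v) $$ (i,j)"
    using index_mult_diag[OF M v ij] by (simp add: power_mult_distrib power2_eq_square)
qed (use M v diag_carrier in auto)

lemma first_moment_mult_diag:
  assumes "\<And>\<tau>. \<tau> \<le> t \<Longrightarrow> X \<tau> \<in> carrier_mat k r" "v \<in> carrier_vec r"
    and "\<And>\<tau>. \<tau> \<le> t \<Longrightarrow> Y \<tau> = X \<tau> * diag v"
  shows "first_moment \<rho> t Y = first_moment \<rho> t X * diag v"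
  unfolding first_moment_def by (rule ema_mult_diag[OF assms])

text \<open>\<open>ema_mult_diag\<close> applies twice: first to the once-scaled squares, then to
  the plain squares.\<close>

lemma second_moment_mult_diag:
  assumes X: "\<And>\<tau>. \<tau> \<le> t \<Longrightarrow> X \<tau> \<in> carrier_mat k r" and v: "v \<in> carrier_vec r"
    and Y: "\<And>\<tau>. \<tau> \<le> t \<Longrightarrow> Y \<tau> = X \<tau> * diag v"
  shows "second_moment \<rho> t Y = second_moment \<rho> t X * diag v * diag v"
proof -
  let ?S = "\<lambda>\<tau>. map_mat (\<lambda>x. x\<^sup>2) (X \<tau>)"
  have S: "?S \<tau> \<in> carrier_mat k r" and SD: "?S \<tau> * diag v \<in> carrier_mat k r" if "\<tau> \<le> t" for \<tau>
    using X[OF that] diag_carrier[OF v] by auto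
  have "second_moment \<rho> t Y = ema \<rho> t (\<lambda>\<tau>. ?S \<tau> * diag v) * diag v"
    unfolding second_moment_def
    by (rule ema_mult_diag[OF SD v]) (auto simp: Y map_mat_square_mult_diag[OF X v])
  also have "ema \<rho> t (\<lambda>\<tau>. ?S \<tau> * diag v) = ema \<rho> t ?S * diag v"
    by (rule ema_mult_diag[OF S v]) auto
  finally show ?thesis by (simp add: second_moment_def)
qed

lemma first_moment_carrier: "X t \<in> carrier_mat k r \<Longrightarrow> first_moment \<rho> t X \<in> carrier_mat k r"
  by (simp add: first_moment_def ema_carrier)

lemma second_moment_carrier: "X t \<in> carrier_mat k r \<Longrightarrow> second_moment \<rho> t X \<in> carrier_mat k r"
  by (simp add: second_moment_def ema_carrier)

text \<open>\<open>grad\<close> is a choice, so its dimensions are known only where some gradient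
  exists; differentiability provides one, and \<open>has_gradient\<close> contains the carrier
  condition.\<close>

lemma grad_carrier:
  assumes "differentiable_loss m n loss" "W \<in> carrier_mat m n"
  shows "grad loss W \<in> carrier_mat m n"
proof -
  have "\<exists>G. has_gradient loss G W" using assms by (auto simp: differentiable_loss_def)
  then have "has_gradient loss (grad loss W) W" unfolding grad_def by (rule someI_ex)
  then show ?thesis using assms(2) by (auto simp: has_gradient_def)
qed

section \<open>Scaling the columns of an array\<close>

text \<open>The row bound \<open>y\<close> is a parameter so that one program serves arrays with
  \<open>m\<close> and with \<open>n\<close> rows. \<open>Lit 0\<close> is the row in which
  \<open>stores_vec\<close> keeps a vector.\<close>

definition scale_columns :: "string \<Rightarrow> string \<Rightarrow> string \<Rightarrow> string \<Rightarrow> program" where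
  "scale_columns y d a v = For ''i'' y (For ''j'' ''r''
     (Arith (Cell d (Var ''i'') (Var ''j'')) Mul
       (Cell a (Var ''i'') (Var ''j'')) (Cell v (Lit 0) (Var ''j''))))"

text \<open>Restated without the store argument, so that the simplifier can unfold \<open>exec\<close> inside the
  partially applied loop body.\<close>

lemma exec_Arith_eta:
  "exec (Arith d f a b) \<sigma> = (\<lambda>s. set_cell \<sigma> s d (apply_op f (get_cell \<sigma> s a) (get_cell \<sigma> s b)))"
  by (simp add: fun_eq_iff)

lemma exec_For_eta: "exec (For x y c) \<sigma> = fold (\<lambda>k. exec c (\<sigma>(x := k))) [0..<\<sigma> y]"
  by (simp add: fun_eq_iff)

text \<open>Induction on the number of finished iterations. Since \<open>d \<noteq> v\<close>, the
  writes leave the factors intact, and cells not yet reached keep their initial values; so the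
  result can be expressed in the initial store.\<close>

lemma fold_scale_row:
  fixes s :: store
  assumes "d \<noteq> v"
  shows "fold (\<lambda>j s. s(d := (s d)(i := (s d i)(j := s a i j * s v 0 j)))) [0..<k] s
    = s(d := (s d)(i := (\<lambda>j. if j < k then s a i j * s v 0 j else s d i j)))"
  using assms by (induction k) (auto simp: fun_eq_iff)

text \<open>The loop body is the result of \<open>fold_scale_row\<close>; the same induction now
  runs over rows.\<close>

lemma fold_scale_columns:
  fixes s :: store
  assumes "d \<noteq> v"
  shows "fold (\<lambda>i s. s(d := (s d)(i := (\<lambda>j. if j < r then s a i j * s v 0 j else s d i j)))) [0..<k] s
    = s(d := (\<lambda>i j. if i < k \<and> j < r then s a i j * s v 0 j else s d i j))"
  using assms by (induction k) (auto simp: fun_eq_iff)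

text \<open>The destination \<open>d\<close> may coincide with the source \<open>a\<close>, because each entry is read only just before
  it is overwritten.\<close>

lemma exec_scale_columns:
  assumes "d \<noteq> v"
  shows "exec (scale_columns y d a v) \<sigma> s
    = s(d := (\<lambda>i j. if i < \<sigma> y \<and> j < \<sigma> ''r'' then s a i j * s v 0 j else s d i j))"
  unfolding scale_columns_def
  by (simp add: exec_For_eta exec_Arith_eta fold_scale_row[OF assms, abs_def] fold_scale_columns[OF assms])

text \<open>Each entry costs a multiplication and a counter increment, and each row one further
  increment.\<close>

lemma time_scale_columns: "time (scale_columns y d a v) \<sigma> = \<sigma> y * (2 * \<sigma> ''r'' + 1)"
  by (simp add: scale_columns_def)

lemma stores_mat_scale_columns:
  assumes "stores_mat s a M" "stores_vec s v w"
    and "M \<in> carrier_mat (\<sigma> y) (\<sigma> ''r'')" "w \<in> carrier_vec (\<sigma> ''r'')" "d \<noteq> v"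
  shows "stores_mat (exec (scale_columns y d a v) \<sigma> s) d (M * diag w)"
  using assms diag_carrier[OF assms(4)]
  \<comment> \<open>Without the deletion, entries of \<open>M * diag w\<close> would be expanded
    into scalar products before \<open>index_mult_diag\<close> applies.\<close>
  by (auto simp: stores_mat_def stores_vec_def exec_scale_columns index_mult_diag simp del: index_mult_mat(1))

text \<open>Frame rule: only the array \<open>d\<close> is written.\<close>

lemma stores_mat_scale_columns_other:
  "\<lbrakk>b \<noteq> d; d \<noteq> v\<rbrakk> \<Longrightarrow> stores_mat (exec (scale_columns y d a v) \<sigma> s) b M = stores_mat s b M"
  by (simp add: stores_mat_def exec_scale_columns)

lemma stores_vec_scale_columns_other:
  "\<lbrakk>b \<noteq> d; d \<noteq> v\<rbrakk> \<Longrightarrow> stores_vec (exec (scale_columns y d a v) \<sigma> s) b w = stores_vec s b w"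
  by (simp add: stores_vec_def exec_scale_columns)

section \<open>Rescaling both moments of one adapter\<close>

text \<open>The last pass works in place on \<open>v'\<close>, supplying the second factor for the
  second moment.\<close>

definition rescale_moments :: "string \<Rightarrow> string \<Rightarrow> string \<Rightarrow> string \<Rightarrow> string \<Rightarrow> string \<Rightarrow> program" where
  "rescale_moments y m' m v' v w =
     Seq (scale_columns y m' m w) (Seq (scale_columns y v' v w) (scale_columns y v' v' w))"

lemma time_rescale_moments:
  "time (rescale_moments y m' m v' v w) \<sigma> = 3 * \<sigma> y * (2 * \<sigma> ''r'' + 1)"
  by (simp add: rescale_moments_def time_scale_columns)

lemma stores_mat_rescale_moments_other:
  "\<lbrakk>b \<noteq> m'; b \<noteq> v'; m' \<noteq> w; v' \<noteq> w\<rbrakk> \<Longrightarrow>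
    stores_mat (exec (rescale_moments y m' m v' v w) \<sigma> s) b M = stores_mat s b M"
  by (simp add: rescale_moments_def stores_mat_scale_columns_other)

lemma stores_vec_rescale_moments_other:
  "\<lbrakk>b \<noteq> m'; b \<noteq> v'; m' \<noteq> w; v' \<noteq> w\<rbrakk> \<Longrightarrow>
    stores_vec (exec (rescale_moments y m' m v' v w) \<sigma> s) b u = stores_vec s b u"
  by (simp add: rescale_moments_def stores_vec_scale_columns_other)

text \<open>The inequalities with \<open>w\<close> protect the scaling vector,
  \<open>m' \<noteq> v\<close> protects the second input from the first pass, and
  \<open>m' \<noteq> v'\<close> protects the first output from the later passes.\<close>

lemma rescale_moments_correct:
  assumes X: "\<And>\<tau>. \<tau> \<le> t \<Longrightarrow> X \<tau> \<in> carrier_mat (\<sigma> y) (\<sigma> ''r'')"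
    and u: "u \<in> carrier_vec (\<sigma> ''r'')"
    and Y: "\<And>\<tau>. \<tau> \<le> t \<Longrightarrow> Y \<tau> = X \<tau> * diag u"
    and s: "stores_vec s w u" "stores_mat s m (first_moment \<rho> t X)"
      "stores_mat s v (second_moment \<rho>' t X)"
    and distinct: "m' \<noteq> w" "v' \<noteq> w" "m' \<noteq> v'" "m' \<noteq> v"
  shows "stores_mat (exec (rescale_moments y m' m v' v w) \<sigma> s) m' (first_moment \<rho> t Y)"
    and "stores_mat (exec (rescale_moments y m' m v' v w) \<sigma> s) v' (second_moment \<rho>' t Y)"
proof -
  have F: "first_moment \<rho> t X \<in> carrier_mat (\<sigma> y) (\<sigma> ''r'')"
    and S: "second_moment \<rho>' t X \<in> carrier_mat (\<sigma> y) (\<sigma> ''r'')"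
    using X by (auto intro: first_moment_carrier second_moment_carrier)
  have FY: "first_moment \<rho> t Y = first_moment \<rho> t X * diag u"
    by (rule first_moment_mult_diag[OF X u Y])
  have SY: "second_moment \<rho>' t Y = second_moment \<rho>' t X * diag u * diag u"
    by (rule second_moment_mult_diag[OF X u Y])
  note SD = mult_carrier_mat[OF S diag_carrier[OF u]]
  show "stores_mat (exec (rescale_moments y m' m v' v w) \<sigma> s) m' (first_moment \<rho> t Y)"
    unfolding rescale_moments_def FY
    using stores_mat_scale_columns[OF s(2,1) F u, of m'] distinct
    by (simp add: stores_mat_scale_columns_other)
  show "stores_mat (exec (rescale_moments y m' m v' v w) \<sigma> s) v' (second_moment \<rho>' t Y)"
    unfolding rescale_moments_def SY exec.simps
    \<comment> \<open>Backwards from the in-place pass: the scaling rule is used for both passes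
      over \<open>v'\<close>, with \<open>SD\<close> typing the intermediate product.\<close>
    by (intro stores_mat_scale_columns S SD u)
      (use s distinct in \<open>auto simp: stores_mat_scale_columns_other stores_vec_scale_columns_other\<close>)
qed

theorem lemma3p6:
  shows "\<exists>(P :: program) (C :: real). \<forall>(m::nat) (n::nat) (r::nat).
    0 < m \<longrightarrow> 0 < n \<longrightarrow> 0 < r \<longrightarrow>
    (\<forall>(loss :: real mat \<Rightarrow> real) (\<rho>1::real) (\<rho>2::real) (t::nat)
      (W :: nat \<Rightarrow> real mat) (Wpt :: nat \<Rightarrow> real mat) (Wpt' :: nat \<Rightarrow> real mat)
      (A :: nat \<Rightarrow> real mat) (B :: nat \<Rightarrow> real mat) (A' :: nat \<Rightarrow> real mat) (B' :: nat \<Rightarrow> real mat)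
      (\<alpha> :: real vec) (\<beta> :: real vec) (\<sigma> :: env) (s :: store).
      differentiable_loss m n loss \<longrightarrow>
      0 < \<rho>1 \<and> \<rho>1 < 1 \<and> 0 < \<rho>2 \<and> \<rho>2 < 1 \<longrightarrow>
      \<alpha> \<in> carrier_vec r \<and> \<beta> \<in> carrier_vec r \<longrightarrow>
      (\<forall>\<tau>\<le>t. Wpt \<tau> \<in> carrier_mat m n \<and> Wpt' \<tau> \<in> carrier_mat m n \<and>
             A \<tau> \<in> carrier_mat m r \<and> B \<tau> \<in> carrier_mat n r \<and>
             A' \<tau> = A \<tau> * diag \<alpha> \<and> B' \<tau> = B \<tau> * diag \<beta> \<and>
             W \<tau> = Wpt \<tau> + A \<tau> * transpose_mat (B \<tau>) \<and>
             W \<tau> = Wpt' \<tau> + A' \<tau> * transpose_mat (B' \<tau>)) \<longrightarrow>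
      \<sigma> ''m'' = m \<and> \<sigma> ''n'' = n \<and> \<sigma> ''r'' = r \<longrightarrow>
      stores_vec s ''alpha'' \<alpha> \<and> stores_vec s ''beta'' \<beta> \<and>
      stores_mat s ''mA'' (first_moment \<rho>1 t (\<lambda>\<tau>. grad_A loss (W \<tau>) (B \<tau>))) \<and>
      stores_mat s ''vA'' (second_moment \<rho>2 t (\<lambda>\<tau>. grad_A loss (W \<tau>) (B \<tau>))) \<and>
      stores_mat s ''mB'' (first_moment \<rho>1 t (\<lambda>\<tau>. grad_B loss (W \<tau>) (A \<tau>))) \<and>
      stores_mat s ''vB'' (second_moment \<rho>2 t (\<lambda>\<tau>. grad_B loss (W \<tau>) (A \<tau>))) \<longrightarrow>
      (let s' = exec P \<sigma> s in
        stores_mat s' ''mA_tilde'' (first_moment \<rho>1 t (\<lambda>\<tau>. grad_A loss (W \<tau>) (B' \<tau>))) \<and>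
        stores_mat s' ''vA_tilde'' (second_moment \<rho>2 t (\<lambda>\<tau>. grad_A loss (W \<tau>) (B' \<tau>))) \<and>
        stores_mat s' ''mB_tilde'' (first_moment \<rho>1 t (\<lambda>\<tau>. grad_B loss (W \<tau>) (A' \<tau>))) \<and>
        stores_mat s' ''vB_tilde'' (second_moment \<rho>2 t (\<lambda>\<tau>. grad_B loss (W \<tau>) (A' \<tau>)))) \<and>
      real (time P \<sigma>) \<le> C * (real (m + n) * real r))"
proof -
  \<comment> \<open>The vectors are crossed: \<open>grad_A\<close> contains \<open>B\<close>, hence
    \<open>beta\<close>; \<open>grad_B\<close> contains \<open>A\<close>, hence
    \<open>alpha\<close>.\<close>
  define PA where "PA = rescale_moments ''m'' ''mA_tilde'' ''mA'' ''vA_tilde'' ''vA'' ''beta''"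
  define PB where "PB = rescale_moments ''n'' ''mB_tilde'' ''mB'' ''vB_tilde'' ''vB'' ''alpha''"
  show ?thesis
  \<comment> \<open>The constant is 9 = 3 * 3: three passes per adapter, and
    \<open>2 * r + 1 \<le> 3 * r\<close> for positive \<open>r\<close>.\<close>
  proof (rule exI[of _ "Seq PA PB"], rule exI[of _ 9], intro allI impI, goal_cases)
    case (1 m n r loss \<rho>1 \<rho>2 t W Wpt Wpt' A B A' B' \<alpha> \<beta> \<sigma> s)
    note \<sigma> = \<open>\<sigma> ''m'' = m \<and> \<sigma> ''n'' = n \<and> \<sigma> ''r'' = r\<close>
    have G: "grad loss (W \<tau>) \<in> carrier_mat m n" if "\<tau> \<le> t" for \<tau>
    proof (rule grad_carrier[OF 1(4)])
      show "W \<tau> \<in> carrier_mat m n" using 1(7) that by auto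
    qed
    have D: "diag \<alpha> \<in> carrier_mat r r" "diag \<beta> \<in> carrier_mat r r"
      using 1(6) by (auto intro: diag_carrier)
    have gA: "grad_A loss (W \<tau>) (B \<tau>) \<in> carrier_mat (\<sigma> ''m'') (\<sigma> ''r'')"
      and gB: "grad_B loss (W \<tau>) (A \<tau>) \<in> carrier_mat (\<sigma> ''n'') (\<sigma> ''r'')"
      and gA': "grad_A loss (W \<tau>) (B' \<tau>) = grad_A loss (W \<tau>) (B \<tau>) * diag \<beta>"
      and gB': "grad_B loss (W \<tau>) (A' \<tau>) = grad_B loss (W \<tau>) (A \<tau>) * diag \<alpha>"
      if "\<tau> \<le> t" for \<tau>
    proof -
      have AB: "A \<tau> \<in> carrier_mat m r" "B \<tau> \<in> carrier_mat n r"
        "A' \<tau> = A \<tau> * diag \<alpha>" "B' \<tau> = B \<tau> * diag \<beta>" using 1(7) that by auto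
      have GT: "transpose_mat (grad loss (W \<tau>)) \<in> carrier_mat n m" using G[OF that] by simp
      show "grad_A loss (W \<tau>) (B \<tau>) \<in> carrier_mat (\<sigma> ''m'') (\<sigma> ''r'')"
        "grad_B loss (W \<tau>) (A \<tau>) \<in> carrier_mat (\<sigma> ''n'') (\<sigma> ''r'')"
        using G[OF that] AB \<sigma> by (auto simp: grad_A_def grad_B_def)
      \<comment> \<open>The gradient at the common \<open>W \<tau>\<close> is unchanged, so
        associativity alone moves the diagonal factor outside.\<close>
      show "grad_A loss (W \<tau>) (B' \<tau>) = grad_A loss (W \<tau>) (B \<tau>) * diag \<beta>"
        unfolding grad_A_def AB(4) using assoc_mult_mat[OF G[OF that] AB(2) D(2)] by simp
      show "grad_B loss (W \<tau>) (A' \<tau>) = grad_B loss (W \<tau>) (A \<tau>) * diag \<alpha>"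
        unfolding grad_B_def AB(3) using assoc_mult_mat[OF GT AB(1) D(1)] by simp
    qed
    have u: "\<alpha> \<in> carrier_vec (\<sigma> ''r'')" "\<beta> \<in> carrier_vec (\<sigma> ''r'')" using 1(6) \<sigma> by auto
    have PA: "stores_mat (exec PA \<sigma> s) ''mA_tilde'' (first_moment \<rho>1 t (\<lambda>\<tau>. grad_A loss (W \<tau>) (B' \<tau>)))"
      "stores_mat (exec PA \<sigma> s) ''vA_tilde'' (second_moment \<rho>2 t (\<lambda>\<tau>. grad_A loss (W \<tau>) (B' \<tau>)))"
      unfolding PA_def
      by (rule rescale_moments_correct[where \<rho> = \<rho>1 and \<rho>' = \<rho>2 and X = "\<lambda>\<tau>. grad_A loss (W \<tau>) (B \<tau>)",
            OF gA u(2) gA'];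
          use 1(9) in simp)+
    \<comment> \<open>\<open>PB\<close> starts from the store left by \<open>PA\<close>, which has
      written only to its two output arrays.\<close>
    have kept: "stores_vec (exec PA \<sigma> s) ''alpha'' \<alpha>"
      "stores_mat (exec PA \<sigma> s) ''mB'' (first_moment \<rho>1 t (\<lambda>\<tau>. grad_B loss (W \<tau>) (A \<tau>)))"
      "stores_mat (exec PA \<sigma> s) ''vB'' (second_moment \<rho>2 t (\<lambda>\<tau>. grad_B loss (W \<tau>) (A \<tau>)))"
      using 1(9) by (auto simp: PA_def stores_mat_rescale_moments_other stores_vec_rescale_moments_other)
    have PB: "stores_mat (exec PB \<sigma> (exec PA \<sigma> s)) ''mB_tilde''
        (first_moment \<rho>1 t (\<lambda>\<tau>. grad_B loss (W \<tau>) (A' \<tau>)))"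
      "stores_mat (exec PB \<sigma> (exec PA \<sigma> s)) ''vB_tilde''
        (second_moment \<rho>2 t (\<lambda>\<tau>. grad_B loss (W \<tau>) (A' \<tau>)))"
      unfolding PB_def
      by (rule rescale_moments_correct[where \<rho> = \<rho>1 and \<rho>' = \<rho>2 and X = "\<lambda>\<tau>. grad_B loss (W \<tau>) (A \<tau>)",
            OF gB u(1) gB'];
          use kept in simp)+
    have "time (Seq PA PB) \<sigma> = 3 * ((m + n) * (2 * r + 1))"
      using \<sigma> by (simp add: PA_def PB_def time_rescale_moments algebra_simps)
    also have "\<dots> \<le> 3 * ((m + n) * (3 * r))"
      using \<open>0 < r\<close> by (intro mult_le_mono) auto
    finally have "real (time (Seq PA PB) \<sigma>) \<le> real (3 * ((m + n) * (3 * r)))"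
      by (rule of_nat_mono)
    then have "real (time (Seq PA PB) \<sigma>) \<le> 9 * (real (m + n) * real r)"
      by (simp add: algebra_simps)
    \<comment> \<open>Conversely, \<open>PB\<close> leaves the outputs of \<open>PA\<close>
      intact.\<close>
    moreover have "stores_mat (exec PB \<sigma> (exec PA \<sigma> s)) b M = stores_mat (exec PA \<sigma> s) b M"
      if "b \<in> {''mA_tilde'', ''vA_tilde''}" for b M
      using that by (auto simp: PB_def stores_mat_rescale_moments_other)
    ultimately show ?case
      using PA PB kept 1(9) by (simp add: Let_def)
  qed
qed

end
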